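(* For every real $\varepsilon>0$ there exists a constant $C>0$ such that for every $k\in\mathbb{N}$ there is a solution of (PTE$_2$) of degree $k$ and size at most $Ck^{3+\varepsilon}$. That is, for every $k\in\mathbb{N}$ there exist $n\in\mathbb{N}$ with $n\leq Ck^{3+\varepsilon}$ and two different multi-sets $\{x_1,\dots,x_n\},\{y_1,\dots,y_n\}\subseteq\mathbb{Z}^2$, where $x_i=(\xi_{i1},\xi_{i2})$ and $y_i=(\eta_{i1},\eta_{i2})$ for $i=1,\dots,n$, such that $$\sum_{i=1}^n \xi_{i1}^{j_1}\xi_{i2}^{j_2}=\sum_{i=1}^n \eta_{i1}^{j_1}\eta_{i2}^{j_2}$$ for all nonnegative integers $j_1,j_2$ with $j_1+j_2\leq k$.
   Context: $\mathbb{N}=\{1,2,\dots\}$. The problem (PTE$_2$) (two-dimensional Prouhet-Tarry-Escott problem) asks, given $k,n\in\mathbb{N}$, for two different multi-sets of $n$ points each in $\mathbb{Z}^2$ satisfying the displayed equations for all nonnegative integers $j_1,j_2$ with $j_1+j_2\leq k$; $k$ is called the degree and $n$ the size of the solution. The convention $0^0=1$ is used. *)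

theory Defs
  imports Complex_Main "HOL-Library.Multiset"
begin

(* X and Y form a solution of degree k and size n of the two-dimensional
   Prouhet-Tarry-Escott problem. X and Y need only differ as multisets; they may
   share points. The convention 0^0 = 1 is that of the power operation on int. *)
definition pte2_solution ::
  "nat \<Rightarrow> nat \<Rightarrow> (int \<times> int) multiset \<Rightarrow> (int \<times> int) multiset \<Rightarrow> bool" where
  "pte2_solution k n X Y \<longleftrightarrow>
     size X = n \<and> size Y = n \<and> X \<noteq> Y \<and>
     (\<forall>j1 j2. j1 + j2 \<le> k \<longrightarrow>
        (\<Sum>(a, b)\<in>#X. a ^ j1 * b ^ j2) = (\<Sum>(a, b)\<in>#Y. a ^ j1 * b ^ j2))"

end

theory Submission
  imports Defs "HOL-Library.FuncSet"
begin

text \<open>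
  The proof is a counting argument. Among the multisets of \<open>n\<close> points in the grid \<open>{1..n} \<times> {1..n}\<close>,
  consider only the graphs of functions from \<open>{1..n}\<close> to itself: there are \<open>n ^ n\<close> of them, and
  they are pairwise different. Each of the at most \<open>(k + 1)\<^sup>2\<close> moments with \<open>j1 + j2 \<le> k\<close> is a sum
  of \<open>n\<close> numbers between \<open>1\<close> and \<open>n ^ k\<close>, hence takes at most \<open>n ^ (k + 1)\<close> values on these graphs,
  and so there are at most \<open>n ^ (k + 1) ^ 3\<close> vectors of moments. As soon as \<open>n > (k + 1) ^ 3\<close>,
  two different graphs have the same moments (\<open>pte2_solution_exists\<close>).

  Since \<open>(k + 1) ^ 3 + 1 \<le> 9 * k ^ 3\<close> for \<open>k \<ge> 1\<close>, the constant \<open>C = 9\<close> serves for every \<open>\<epsilon>\<close>.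
\<close>

text \<open>
  One point in each of the columns \<open>1, \<dots>, n\<close>: such a multiset has size \<open>n\<close> and determines \<open>f\<close> on
  \<open>{1..n}\<close>, so counting these multisets amounts to counting functions.
\<close>

definition graph_mset :: "nat \<Rightarrow> (nat \<Rightarrow> nat) \<Rightarrow> (int \<times> int) multiset" where
  "graph_mset n f = image_mset (\<lambda>i. (int i, int (f i))) (mset_set {1..n})"

definition graph_moment :: "nat \<Rightarrow> (nat \<Rightarrow> nat) \<Rightarrow> nat \<times> nat \<Rightarrow> nat" where
  "graph_moment n f = (\<lambda>(j1, j2). \<Sum>i=1..n. i ^ j1 * f i ^ j2)"

lemma size_graph_mset: "size (graph_mset n f) = n"
  by (simp add: graph_mset_def)

lemma inj_on_graph_mset: "inj_on (graph_mset n) ({1..n} \<rightarrow>\<^sub>E B)"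
proof (rule inj_onI)
  fix f g
  assume f: "f \<in> {1..n} \<rightarrow>\<^sub>E B" and g: "g \<in> {1..n} \<rightarrow>\<^sub>E B"
    and eq: "graph_mset n f = graph_mset n g"
  have graph: "set_mset (graph_mset n h) = (\<lambda>i. (int i, int (h i))) ` {1..n}" for h
    by (simp add: graph_mset_def)
  have "f i = g i" if "i \<in> {1..n}" for i
  proof -
    have "(int i, int (f i)) \<in> set_mset (graph_mset n g)"
      unfolding eq [symmetric] graph using that by blast
    then show ?thesis
      unfolding graph by auto
  qed
  with f g show "f = g"
    by (rule PiE_ext)
qed

lemma moment_graph_mset:
  "(\<Sum>(a, b)\<in>#graph_mset n f. a ^ j1 * b ^ j2) = int (graph_moment n f (j1, j2))"
  by (simp add: graph_mset_def graph_moment_def sum_unfold_sum_mset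
      multiset.map_comp comp_def)

lemma graph_moment_range:
  assumes f: "f \<in> {1..n} \<rightarrow> {1..n}" and n: "n \<ge> 1" and k: "j1 + j2 \<le> k"
  shows "graph_moment n f (j1, j2) \<in> {1..n ^ (k + 1)}"
proof -
  have f_bounds: "1 \<le> f i \<and> f i \<le> n" if "i \<in> {1..n}" for i
    using f that by (auto simp: Pi_iff)
  have lower: "1 \<le> i ^ j1 * f i ^ j2" if "i \<in> {1..n}" for i
    using f_bounds [OF that] that by simp
  have upper: "i ^ j1 * f i ^ j2 \<le> n ^ k" if "i \<in> {1..n}" for i
  proof -
    have "i ^ j1 * f i ^ j2 \<le> n ^ j1 * n ^ j2"
      using f_bounds [OF that] that by (intro mult_le_mono power_mono) auto
    also have "\<dots> = n ^ (j1 + j2)"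
      by (simp add: power_add)
    also have "\<dots> \<le> n ^ k"
      using n k by (rule power_increasing [rotated])
    finally show ?thesis .
  qed
  have "n \<le> (\<Sum>i=1..n. i ^ j1 * f i ^ j2)"
    using sum_mono [of "{1..n}" "\<lambda>_. 1" "\<lambda>i. i ^ j1 * f i ^ j2"] lower by simp
  moreover have "(\<Sum>i=1..n. i ^ j1 * f i ^ j2) \<le> n * n ^ k"
    using sum_bounded_above [of "{1..n}" "\<lambda>i. i ^ j1 * f i ^ j2" "n ^ k"] upper by simp
  ultimately show ?thesis
    using n by (simp add: graph_moment_def)
qed

lemma pte2_solution_exists:
  assumes n: "n > (k + 1) ^ 3"
  shows "\<exists>X Y. pte2_solution k n X Y"
proof -
  define F where "F = {1..n} \<rightarrow>\<^sub>E {1..n}"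
  define J where "J = {(j1, j2). j1 + j2 \<le> k}"
  \<comment> \<open>Restriction to \<open>J\<close> makes the possible moment vectors a finite set that can be counted.\<close>
  define moments where "moments f = restrict (graph_moment n f) J" for f
  define V where "V = J \<rightarrow>\<^sub>E {1..n ^ (k + 1)}"
  have "(k + 1) ^ 3 \<ge> 1"
    by simp
  with n have n2: "n > 1"
    by linarith
  have J_sub: "J \<subseteq> {..k} \<times> {..k}"
    by (auto simp: J_def)
  then have fin_J: "finite J"
    by (rule finite_subset) simp
  have card_J: "card J \<le> (k + 1) ^ 2"
    using card_mono [OF _ J_sub] by (simp add: power2_eq_square)
  have fin_V: "finite V"
    unfolding V_def using fin_J by (intro finite_PiE) auto
  have "moments ` F \<subseteq> V"
  proof
    fix v assume "v \<in> moments ` F"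
    then obtain f where f: "f \<in> {1..n} \<rightarrow> {1..n}" and v: "v = restrict (graph_moment n f) J"
      by (auto simp: F_def moments_def PiE_def)
    show "v \<in> V"
      unfolding v V_def restrict_PiE_iff
      using graph_moment_range [OF f] n2 by (auto simp: J_def)
  qed
  then have "card (moments ` F) \<le> card V"
    by (rule card_mono [OF fin_V])
  also have "\<dots> = n ^ ((k + 1) * card J)"
    unfolding V_def power_mult using fin_J by (simp add: card_funcsetE)
  also have "\<dots> \<le> n ^ ((k + 1) * (k + 1) ^ 2)"
    using n2 card_J by (intro power_increasing mult_le_mono2) simp_all
  also have "\<dots> = n ^ (k + 1) ^ 3"
    by (simp only: power3_eq_cube power2_eq_square mult.assoc)
  also have "\<dots> < n ^ n"
    using n2 n by (rule power_strict_increasing [rotated])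
  also have "\<dots> = card F"
    by (simp add: F_def card_funcsetE)
  finally have "\<not> inj_on moments F"
    by (rule pigeonhole)
  then obtain f g where fg: "f \<in> F" "g \<in> F" "f \<noteq> g" and eq: "moments f = moments g"
    by (auto simp: inj_on_def)
  have "graph_moment n f (j1, j2) = graph_moment n g (j1, j2)" if "j1 + j2 \<le> k" for j1 j2
    using fun_cong [OF eq, of "(j1, j2)"] that by (simp add: moments_def J_def)
  moreover have "graph_mset n f \<noteq> graph_mset n g"
    using inj_onD [OF inj_on_graph_mset] fg unfolding F_def by blast
  ultimately have "pte2_solution k n (graph_mset n f) (graph_mset n g)"
    by (simp add: pte2_solution_def size_graph_mset moment_graph_mset)
  then show ?thesis
    by blast
qed

theorem corollary4p2:
  shows "\<forall>\<epsilon>::real. \<epsilon> > 0 \<longrightarrow>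
    (\<exists>C::real. C > 0 \<and>
      (\<forall>k::nat. k \<ge> 1 \<longrightarrow>
        (\<exists>n::nat. n \<ge> 1 \<and> real n \<le> C * real k powr (3 + \<epsilon>) \<and>
          (\<exists>X Y. pte2_solution k n X Y))))"
proof -
  have "\<exists>n::nat. n \<ge> 1 \<and> real n \<le> 9 * real k powr (3 + \<epsilon>) \<and> (\<exists>X Y. pte2_solution k n X Y)"
    if \<epsilon>: "\<epsilon> > 0" and k: "k \<ge> 1" for \<epsilon> :: real and k :: nat
  proof -
    define n where "n = (k + 1) ^ 3 + 1"
    have "(k + 1) ^ 3 \<le> (2 * k) ^ 3"
      using k by (intro power_mono) auto
    moreover have "1 \<le> k ^ 3"
      using k by simp
    ultimately have "n \<le> 9 * k ^ 3"
      by (simp add: n_def power_mult_distrib)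
    then have "real n \<le> real (9 * k ^ 3)"
      by (simp only: of_nat_le_iff)
    also have "\<dots> = 9 * real k powr 3"
      using k by simp
    also have "\<dots> \<le> 9 * real k powr (3 + \<epsilon>)"
      using k \<epsilon> by (intro mult_left_mono powr_mono) auto
    finally have "real n \<le> 9 * real k powr (3 + \<epsilon>)" .
    moreover have "\<exists>X Y. pte2_solution k n X Y"
      by (rule pte2_solution_exists) (simp add: n_def)
    moreover have "n \<ge> 1"
      by (simp add: n_def)
    ultimately show ?thesis
      by blast
  qed
  then show ?thesis
    by (intro allI impI exI [where x = "9::real"] conjI) simp_all
qed

end
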